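(* \begin{enumerate} \item Suppose $w\in\mathfrak{S}_n$. Then $\mathcal{R}_w$ is a $2$-chain if and only if $w$ is a Coxeter element of $\mathfrak{S}_n$. \item Every $n$-element $2$-chain is isomorphic to $\mathcal{R}_w$ for some Coxeter element $w\in\mathfrak{S}_n$. \item Suppose $v$ and $w$ are Coxeter elements of $\mathfrak{S}_n$. Then $\mathcal{R}_v\cong\mathcal{R}_w$ if and only if $v\in\{w,w^{-1}\}$. \end{enumerate}
   Context: All posets are finite; partial orders are written $\preceq$. A poset $(P,\preceq)$ is a $2$-chain if (1) there is a unique way to write $P$ as the union of two chains, and (2) $\preceq$ is maximal subject to (1), i.e. for every proper refinement $\preceq^+$ of $\preceq$ there is more than one way to write $P$ as the union of two $\preceq^+$-chains. $\mathfrak{S}_n$ is the symmetric group on $\{1,\dots,n\}$ with Coxeter generators $s_i=(i,i+1)$, $1\le i\le n-1$; a Coxeter element is a product of the generators $s_1,\dots,s_{n-1}$, each appearing exactly once, in some order. For $w\in\mathfrak{S}_n$, $\mathcal{R}_w$ is the set $\{1,\dots,n\}$ with $i\preceq j$ if and only if $i\leq j$ and $w(i)\leq w(j)$. *)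

theory Defs
  imports "HOL-Combinatorics.Combinatorics"
begin

(* A poset is a carrier set P together with a relation r satisfying partial_order_on P r,
   which includes r \<subseteq> P \<times> P. *)

definition finite_poset :: "'a set \<Rightarrow> 'a rel \<Rightarrow> bool" where
  "finite_poset P r \<longleftrightarrow> finite P \<and> partial_order_on P r"

(* The ways to write P as the union of two chains.  A way is an unordered pair {A, B} of
   disjoint, possibly empty chains.  Without disjointness the one-element poset, which is
   the poset of the Coxeter element of the symmetric group on one point, would have the
   two decompositions {x} = {x} \<union> {} = {x} \<union> {x}.  In any larger poset, an element common
   to both chains could be deleted from either one, so disjointness does not affect
   uniqueness there. *)
definition two_chain_decomps :: "'a set \<Rightarrow> 'a rel \<Rightarrow> 'a set set set" where
  "two_chain_decomps P r =
     {{A, B} | A B. A \<in> Chains r \<and> B \<in> Chains r \<and> A \<union> B = P \<and> A \<inter> B = {}}"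

definition two_chain :: "'a set \<Rightarrow> 'a rel \<Rightarrow> bool" where
  "two_chain P r \<longleftrightarrow>
     finite_poset P r \<and>
     (\<exists>!D. D \<in> two_chain_decomps P r) \<and>
     (\<forall>r'. partial_order_on P r' \<and> r \<subset> r' \<longrightarrow>
        (\<exists>D \<in> two_chain_decomps P r'. \<exists>E \<in> two_chain_decomps P r'. D \<noteq> E))"

definition poset_isomorphic :: "'a set \<Rightarrow> 'a rel \<Rightarrow> 'b set \<Rightarrow> 'b rel \<Rightarrow> bool" where
  "poset_isomorphic P r Q s \<longleftrightarrow>
     (\<exists>f. bij_betw f P Q \<and> (\<forall>x\<in>P. \<forall>y\<in>P. (x, y) \<in> r \<longleftrightarrow> (f x, f y) \<in> s))"

(* Elements of the symmetric group on {1..n} are functions w with w permutes {1..n};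
   the group operation is composition. *)

definition coxeter_gen :: "nat \<Rightarrow> nat \<Rightarrow> nat" where
  "coxeter_gen i = transpose i (i + 1)"

definition coxeter_element :: "nat \<Rightarrow> (nat \<Rightarrow> nat) \<Rightarrow> bool" where
  "coxeter_element n w \<longleftrightarrow>
     (\<exists>is. distinct is \<and> set is = {1..<n} \<and> w = foldr (\<circ>) (map coxeter_gen is) id)"

(* The order of the poset R_w, whose carrier is {1..n}. *)
definition perm_order :: "nat \<Rightarrow> (nat \<Rightarrow> nat) \<Rightarrow> nat rel" where
  "perm_order n w = {(i, j). i \<in> {1..n} \<and> j \<in> {1..n} \<and> i \<le> j \<and> w i \<le> w j}"

end

theory Submission
  imports Defs
begin

text \<open>
  Decompositions into two chains are the proper 2-colourings of the incomparability graph. In a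
  2-chain this graph has no 4-cycle formed by two comparable pairs, since otherwise an incomparable
  pair on an extremal such cycle could be made comparable without creating a new decomposition.
  If \<open>R_w\<close> has a unique decomposition and no such 4-cycle, then \<open>w(n) = n + 1\<close> or \<open>w(n + 1) = n\<close>
  for \<open>w\<close> in the symmetric group on \<open>n + 1\<close> points, so up to inversion \<open>w = u s_n\<close>, where \<open>u\<close> fixes
  \<open>n + 1\<close>. In the poset, the passage from \<open>u\<close> to \<open>w\<close> attaches a leaf to the incomparability graph;
  this preserves the relevant properties in both directions, and Coxeter elements satisfy the same
  recursion.

  The incomparable pairs can be directed from one chain to the other or back. The two resulting
  linear extensions realize any poset with a decomposition as some \<open>R_w\<close>, and a unique decomposition
  determines this pair of extensions up to exchange, that is, \<open>w\<close> up to inversion.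
\<close>

section \<open>Decompositions into two chains\<close>

text \<open>On the carrier of a partial order, reflexivity makes incomparable elements distinct, so
  this is the edge relation of a loopless graph.\<close>

definition incomp :: "'a rel \<Rightarrow> 'a \<Rightarrow> 'a \<Rightarrow> bool" where
  "incomp r x y \<longleftrightarrow> (x, y) \<notin> r \<and> (y, x) \<notin> r"

text \<open>A decomposition is encoded by one of its chains, so each unordered pair
  \<open>{S, P - S}\<close> is represented by both \<open>S\<close> and
  \<open>P - S\<close>.\<close>

definition splits :: "'a set \<Rightarrow> 'a rel \<Rightarrow> 'a set set" where
  "splits P r = {S. S \<subseteq> P \<and> S \<in> Chains r \<and> P - S \<in> Chains r}"

definition unique_split :: "'a set \<Rightarrow> 'a rel \<Rightarrow> bool" where
  "unique_split P r \<longleftrightarrow> (\<exists>S\<in>splits P r. \<forall>T\<in>splits P r. T = S \<or> T = P - S)"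

lemma incomp_sym: "incomp r x y \<longleftrightarrow> incomp r y x"
  by (auto simp: incomp_def)

text \<open>A chain contains no incomparable pair, so \<open>S\<close> is one colour class of a
  proper 2-colouring of the incomparability graph.\<close>

lemma splits_iff:
  "S \<in> splits P r \<longleftrightarrow>
     S \<subseteq> P \<and> (\<forall>x\<in>P. \<forall>y\<in>P. incomp r x y \<longrightarrow> (x \<in> S \<longleftrightarrow> y \<notin> S))"
  unfolding splits_def Chains_def incomp_def by blast

lemma splitsI:
  assumes "S \<subseteq> P" "\<And>x y. x \<in> P \<Longrightarrow> y \<in> P \<Longrightarrow> incomp r x y \<Longrightarrow> x \<in> S \<longleftrightarrow> y \<notin> S"
  shows "S \<in> splits P r"
  using assms by (simp add: splits_iff)

lemma splits_subset: "S \<in> splits P r \<Longrightarrow> S \<subseteq> P"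
  by (simp add: splits_iff)

lemma splits_incomp:
  "S \<in> splits P r \<Longrightarrow> x \<in> P \<Longrightarrow> y \<in> P \<Longrightarrow> incomp r x y \<Longrightarrow> x \<in> S \<longleftrightarrow> y \<notin> S"
  by (simp add: splits_iff)

lemma splits_compl: "S \<in> splits P r \<Longrightarrow> P - S \<in> splits P r"
  by (auto simp: splits_iff)

text \<open>Enlarging the order only deletes edges of the incomparability graph.\<close>

lemma splits_mono: "r \<subseteq> r' \<Longrightarrow> splits P r \<subseteq> splits P r'"
  unfolding splits_iff incomp_def subset_iff by blast

lemma splits_cong:
  assumes "\<And>x y. x \<in> P \<Longrightarrow> y \<in> P \<Longrightarrow> (x, y) \<in> r \<longleftrightarrow> (x, y) \<in> r'"
  shows "splits P r = splits P r'"
proof -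
  have "incomp r x y \<longleftrightarrow> incomp r' x y" if "x \<in> P" "y \<in> P" for x y
    using assms that by (simp add: incomp_def)
  then show ?thesis by (simp add: set_eq_iff splits_iff)
qed

lemma unique_split_Restr: "unique_split P (Restr r P) \<longleftrightarrow> unique_split P r"
  using splits_cong[of P "Restr r P" r] by (auto simp: unique_split_def)

lemma unique_splitD:
  assumes "unique_split P r" "S \<in> splits P r" "T \<in> splits P r"
  shows "T = S \<or> T = P - S"
proof -
  obtain U where "\<forall>T\<in>splits P r. T = U \<or> T = P - U"
    using assms(1) by (auto simp: unique_split_def)
  then have "S = U \<or> S = P - U" "T = U \<or> T = P - U" using assms by auto
  then show ?thesis using assms(2,3)[THEN splits_subset] by auto
qed

lemma two_chain_decomps_eq: "two_chain_decomps P r = (\<lambda>S. {S, P - S}) ` splits P r"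
proof (intro set_eqI iffI)
  fix D assume "D \<in> two_chain_decomps P r"
  then obtain A B where D: "D = {A, B}" "A \<in> Chains r" "B \<in> Chains r" "A \<union> B = P" "A \<inter> B = {}"
    by (auto simp: two_chain_decomps_def)
  then have "B = P - A" by auto
  then show "D \<in> (\<lambda>S. {S, P - S}) ` splits P r" using D by (auto simp: splits_def)
next
  fix D assume "D \<in> (\<lambda>S. {S, P - S}) ` splits P r"
  then obtain S where "S \<in> splits P r" "D = {S, P - S}" by auto
  then show "D \<in> two_chain_decomps P r"
    unfolding two_chain_decomps_def splits_def by blast
qed

lemma ex1_image_iff: "(\<exists>!D. D \<in> f ` X) \<longleftrightarrow> (\<exists>S\<in>X. \<forall>T\<in>X. f T = f S)"
  unfolding Ex1_def bex_simps image_iff Bex_def by metis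

lemma pair_compl_eq_iff:
  "S \<subseteq> P \<Longrightarrow> T \<subseteq> P \<Longrightarrow> {T, P - T} = {S, P - S} \<longleftrightarrow> T = S \<or> T = P - S"
  unfolding doubleton_eq_iff by (metis double_diff order_refl)

lemma ex1_decomp_iff: "(\<exists>!D. D \<in> two_chain_decomps P r) \<longleftrightarrow> unique_split P r"
  unfolding two_chain_decomps_eq ex1_image_iff unique_split_def
  by (intro bex_cong ball_cong refl pair_compl_eq_iff splits_subset)

text \<open>A decomposition survives every refinement, so a refinement never has none, and having
  two is the same as lacking uniqueness.\<close>

lemma two_chain_iff:
  "two_chain P r \<longleftrightarrow> finite P \<and> partial_order_on P r \<and> unique_split P r \<and>
     (\<forall>r'. partial_order_on P r' \<and> r \<subset> r' \<longrightarrow> \<not> unique_split P r')"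
proof -
  have "(\<exists>D\<in>two_chain_decomps P r'. \<exists>E\<in>two_chain_decomps P r'. D \<noteq> E) \<longleftrightarrow> \<not> unique_split P r'"
    if "unique_split P r" "r \<subset> r'" for r'
  proof -
    obtain S where "S \<in> splits P r" using \<open>unique_split P r\<close> by (auto simp: unique_split_def)
    then have "S \<in> splits P r'" using splits_mono[of r r' P] \<open>r \<subset> r'\<close> by auto
    then have "\<exists>D. D \<in> two_chain_decomps P r'" by (auto simp: two_chain_decomps_eq)
    then show ?thesis unfolding ex1_decomp_iff[symmetric] by blast
  qed
  then show ?thesis
    unfolding two_chain_def finite_poset_def ex1_decomp_iff by blast
qed

section \<open>Isomorphisms\<close>

lemma splits_iso:
  assumes f: "bij_betw f P Q" and iso: "\<And>x y. x \<in> P \<Longrightarrow> y \<in> P \<Longrightarrow> (x, y) \<in> r \<longleftrightarrow> (f x, f y) \<in> s"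
    and S: "S \<subseteq> P"
  shows "f ` S \<in> splits Q s \<longleftrightarrow> S \<in> splits P r"
proof -
  have Q: "Q = f ` P" and inj: "inj_on f P" using f by (auto simp: bij_betw_def)
  have "f x \<in> f ` S \<longleftrightarrow> x \<in> S" if "x \<in> P" for x
    using inj that S by (auto dest: inj_onD)
  then show ?thesis using S iso by (auto simp: splits_iff Q incomp_def)
qed

lemma unique_split_iso:
  assumes f: "bij_betw f P Q" and iso: "\<And>x y. x \<in> P \<Longrightarrow> y \<in> P \<Longrightarrow> (x, y) \<in> r \<longleftrightarrow> (f x, f y) \<in> s"
    and uniq: "unique_split P r"
  shows "unique_split Q s"
proof -
  have Q: "Q = f ` P" and inj: "inj_on f P" using f by (auto simp: bij_betw_def)
  obtain S where S: "S \<in> splits P r" "\<forall>T\<in>splits P r. T = S \<or> T = P - S"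
    using uniq by (auto simp: unique_split_def)
  have fS: "f ` S \<in> splits Q s" using splits_iso[OF f iso splits_subset[OF S(1)]] S(1) by simp
  have "T = f ` S \<or> T = Q - f ` S" if T: "T \<in> splits Q s" for T
  proof -
    obtain U where U: "U \<subseteq> P" "T = f ` U"
      using splits_subset[OF T] unfolding Q by (auto simp: subset_image_iff)
    then have "U \<in> splits P r" using splits_iso[OF f iso U(1)] T by simp
    then have "U = S \<or> U = P - S" using S by auto
    moreover have "f ` (P - S) = Q - f ` S"
      using inj_on_image_set_diff[OF inj, of P S] splits_subset[OF S(1)] by (auto simp: Q)
    ultimately show ?thesis using U by auto
  qed
  then show ?thesis unfolding unique_split_def using fS by (intro bexI[of _ "f ` S"] ballI)
qed

lemma poset_isomorphic_unique_split:
  assumes "poset_isomorphic P r Q s" "unique_split P r"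
  shows "unique_split Q s"
proof -
  obtain f where f: "bij_betw f P Q" "\<And>x y. x \<in> P \<Longrightarrow> y \<in> P \<Longrightarrow> (x, y) \<in> r \<longleftrightarrow> (f x, f y) \<in> s"
    using assms(1) by (auto simp: poset_isomorphic_def)
  show ?thesis by (rule unique_split_iso[OF f assms(2)])
qed

lemma poset_isomorphic_sym:
  assumes "poset_isomorphic P r Q s"
  shows "poset_isomorphic Q s P r"
proof -
  obtain f where f: "bij_betw f P Q" "\<forall>x\<in>P. \<forall>y\<in>P. (x, y) \<in> r \<longleftrightarrow> (f x, f y) \<in> s"
    using assms by (auto simp: poset_isomorphic_def)
  define g where "g = inv_into P f"
  have g: "bij_betw g Q P" "\<And>x. x \<in> Q \<Longrightarrow> f (g x) = x"
    unfolding g_def using bij_betw_inv_into[OF f(1)] bij_betw_inv_into_right[OF f(1)] by blast+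
  then have "g x \<in> P" if "x \<in> Q" for x using that by (auto simp: bij_betw_def)
  with f g show ?thesis unfolding poset_isomorphic_def by (intro exI[of _ g]) auto
qed

lemma partial_order_on_pullback:
  assumes f: "inj_on f P" "f ` P = Q" and s: "partial_order_on Q s"
  shows "partial_order_on P {(x, y) \<in> P \<times> P. (f x, f y) \<in> s}"
proof -
  have "refl_on Q s" "trans s" "antisym s" using s by (auto dest: partial_order_onD)
  then show ?thesis unfolding partial_order_on_def preorder_on_def using f
    unfolding refl_on_def antisym_def inj_on_def trans_def by blast
qed

text \<open>Maximality is transported by pulling a refinement of \<open>s\<close> back along the
  isomorphism. The bound on \<open>s\<close> matters because \<open>poset_isomorphic\<close> says
  nothing about pairs outside the carriers.\<close>

lemma two_chain_iso:
  assumes iso: "poset_isomorphic P r Q s" and s: "s \<subseteq> Q \<times> Q" and tc: "two_chain P r"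
  shows "two_chain Q s"
proof -
  obtain f where f: "bij_betw f P Q" "\<And>x y. x \<in> P \<Longrightarrow> y \<in> P \<Longrightarrow> (x, y) \<in> r \<longleftrightarrow> (f x, f y) \<in> s"
    using iso by (auto simp: poset_isomorphic_def)
  obtain g where g: "bij_betw g Q P" "\<And>x y. x \<in> Q \<Longrightarrow> y \<in> Q \<Longrightarrow> (x, y) \<in> s \<longleftrightarrow> (g x, g y) \<in> r"
    using poset_isomorphic_sym[OF iso] by (auto simp: poset_isomorphic_def)
  have fin: "finite P" and po: "partial_order_on P r" and uniq: "unique_split P r"
    and ref: "\<And>r'. partial_order_on P r' \<Longrightarrow> r \<subset> r' \<Longrightarrow> \<not> unique_split P r'"
    using tc by (auto simp: two_chain_iff)
  have rP: "r \<subseteq> P \<times> P" using po by (rule partial_order_onD)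
  have "s = {(x, y) \<in> Q \<times> Q. (g x, g y) \<in> r}" using s g(2) by auto
  moreover have "partial_order_on Q {(x, y) \<in> Q \<times> Q. (g x, g y) \<in> r}"
    using g po by (intro partial_order_on_pullback) (auto simp: bij_betw_def)
  ultimately have "partial_order_on Q s" by simp
  moreover have "finite Q" using fin f(1) by (simp add: bij_betw_finite)
  moreover have "unique_split Q s" by (rule unique_split_iso[OF f uniq])
  moreover have "\<not> unique_split Q s'" if s': "partial_order_on Q s'" "s \<subset> s'" for s'
  proof
    assume u: "unique_split Q s'"
    define r' where "r' = {(x, y) \<in> P \<times> P. (f x, f y) \<in> s'}"
    have "partial_order_on P r'"
      unfolding r'_def using f(1) s' by (intro partial_order_on_pullback) (auto simp: bij_betw_def)
    moreover have "r \<subseteq> r'" using rP f(2) s' by (auto simp: r'_def)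
    moreover have "r \<noteq> r'"
    proof -
      obtain u v where uv: "(u, v) \<in> s'" "(u, v) \<notin> s" using s'(2) by auto
      then have "u \<in> Q" "v \<in> Q" using s'(1) by (auto dest: partial_order_onD)
      then obtain x y where "x \<in> P" "y \<in> P" "u = f x" "v = f y"
        using f(1) by (auto simp: bij_betw_def)
      then show ?thesis using uv f(2) by (auto simp: r'_def)
    qed
    ultimately have "\<not> unique_split P r'" using ref by blast
    moreover have "unique_split P r'"
    proof (rule unique_split_iso[OF _ _ u])
      show h: "bij_betw (inv_into P f) Q P" using f(1) by (rule bij_betw_inv_into)
      show "(x, y) \<in> s' \<longleftrightarrow> (inv_into P f x, inv_into P f y) \<in> r'" if "x \<in> Q" "y \<in> Q" for x y
        using that h f(1) by (auto simp: r'_def bij_betw_inv_into_right bij_betw_def inv_into_into)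
    qed
    ultimately show False by contradiction
  qed
  ultimately show ?thesis by (auto simp: two_chain_iff)
qed

section \<open>Pendant elements\<close>

text \<open>\<open>z\<close> is a leaf of the incomparability graph, attached to \<open>y\<close>;
  \<open>P\<close> is the carrier without \<open>z\<close>.\<close>

definition pendant :: "'a rel \<Rightarrow> 'a set \<Rightarrow> 'a \<Rightarrow> 'a \<Rightarrow> bool" where
  "pendant r P z y \<longleftrightarrow> y \<in> P \<and> z \<notin> P \<and> (z, z) \<in> r \<and> (\<forall>x\<in>P. incomp r x z \<longleftrightarrow> x = y)"

text \<open>A leaf must take the colour opposite to its only neighbour, so every colouring of
  \<open>P\<close> extends in exactly one way.\<close>

lemma splits_pendant:
  assumes z: "pendant r P z y"
  shows "splits (insert z P) r = (\<lambda>T. if y \<in> T then T else insert z T) ` splits P r"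
proof -
  have z': "y \<in> P" "z \<notin> P" "\<not> incomp r z z" "\<And>x. x \<in> P \<Longrightarrow> incomp r x z \<longleftrightarrow> x = y"
    "\<And>x. x \<in> P \<Longrightarrow> incomp r z x \<longleftrightarrow> x = y"
    using z by (auto simp: pendant_def incomp_def)
  show ?thesis
  proof (intro set_eqI iffI)
    fix S assume S: "S \<in> splits (insert z P) r"
    have "z \<in> S \<longleftrightarrow> y \<notin> S" using splits_incomp[OF S, of z y] z' by auto
    then have "S = (if y \<in> S - {z} then S - {z} else insert z (S - {z}))" using z' by auto
    moreover have "S - {z} \<in> splits P r"
    proof (rule splitsI)
      show "S - {z} \<subseteq> P" using splits_subset[OF S] by auto
      show "u \<in> S - {z} \<longleftrightarrow> v \<notin> S - {z}" if "u \<in> P" "v \<in> P" "incomp r u v" for u v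
        using that splits_incomp[OF S, of u v] z'(2) by auto
    qed
    ultimately show "S \<in> (\<lambda>T. if y \<in> T then T else insert z T) ` splits P r" by (rule image_eqI)
  next
    fix S assume "S \<in> (\<lambda>T. if y \<in> T then T else insert z T) ` splits P r"
    then obtain T where T: "T \<in> splits P r" "S = (if y \<in> T then T else insert z T)" by auto
    have "z \<notin> T" using splits_subset[OF T(1)] z' by auto
    show "S \<in> splits (insert z P) r"
    proof (rule splitsI)
      show "S \<subseteq> insert z P" using splits_subset[OF T(1)] T(2) by auto
      fix u v assume uv: "u \<in> insert z P" "v \<in> insert z P" "incomp r u v"
      then consider "u = z" "v = y" | "u = y" "v = z" | "u \<in> P" "v \<in> P" using z' by blast
      then show "u \<in> S \<longleftrightarrow> v \<notin> S"
        using splits_incomp[OF T(1), of u v] uv(3) T(2) \<open>z \<notin> T\<close> z'(1,2) by cases auto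
    qed
  qed
qed

lemma unique_split_pendant:
  assumes z: "pendant r P z y"
  shows "unique_split (insert z P) r \<longleftrightarrow> unique_split P r"
proof -
  define e where "e T = (if y \<in> T then T else insert z T)" for T
  have z': "y \<in> P" "z \<notin> P" using z by (auto simp: pendant_def)
  have e: "splits (insert z P) r = e ` splits P r" using splits_pendant[OF z] by (simp add: e_def)
  have "e T = e S \<longleftrightarrow> T = S" "e T = insert z P - e S \<longleftrightarrow> T = P - S"
    if "S \<in> splits P r" "T \<in> splits P r" for S T
    using that[THEN splits_subset] z' unfolding e_def by (auto split: if_splits)
  then show ?thesis unfolding unique_split_def e by auto
qed

text \<open>A proper refinement that keeps \<open>y\<close> and \<open>z\<close> incomparable is
  already proper on \<open>P\<close>, against maximality there. One that compares them frees
  \<open>z\<close> to join either chain.\<close>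

lemma two_chain_pendant:
  assumes z: "pendant r P z y" and po: "partial_order_on (insert z P) r"
    and tc: "two_chain P (Restr r P)"
  shows "two_chain (insert z P) r"
proof -
  have z': "y \<in> P" "z \<notin> P" and inc: "\<And>x. x \<in> P \<Longrightarrow> incomp r x z \<longleftrightarrow> x = y"
    using z by (auto simp: pendant_def)
  have fin: "finite P" and uniq: "unique_split P r"
    and ref: "\<And>r'. partial_order_on P r' \<Longrightarrow> Restr r P \<subset> r' \<Longrightarrow> \<not> unique_split P r'"
    using tc by (auto simp: two_chain_iff unique_split_Restr)
  have "\<not> unique_split (insert z P) r'"
    if r': "partial_order_on (insert z P) r'" "r \<subset> r'" for r'
  proof
    assume u: "unique_split (insert z P) r'"
    have r'_D: "refl_on (insert z P) r'" "trans r'" "antisym r'" "r' \<subseteq> insert z P \<times> insert z P"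
      using r'(1) by (auto dest: partial_order_onD)
    have zz: "(z, z) \<in> r'" using r'_D(1) by (auto simp: refl_on_def)
    have cmp: "(x, z) \<in> r \<or> (z, x) \<in> r" if "x \<in> P" "x \<noteq> y" for x
      using that inc by (auto simp: incomp_def)
    show False
    proof (cases "incomp r' y z")
      case True
      have pend: "pendant r' P z y"
        using True z' zz r'(2) cmp by (auto simp: pendant_def incomp_def)
      have "partial_order_on P (Restr r' P)"
        using r'_D unfolding partial_order_on_def preorder_on_def
        by (auto simp: refl_on_def antisym_def intro!: transI dest: transD)
      moreover have "Restr r P \<subset> Restr r' P"
      proof -
        \<comment> \<open>A new pair cannot involve \<open>z\<close>: it would compare
          \<open>z\<close> with \<open>y\<close> or reverse a pair of \<open>r\<close>.\<close>
        obtain u v where uv: "(u, v) \<in> r'" "(u, v) \<notin> r" using r'(2) by auto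
        have "(z, z) \<in> r" using z by (simp add: pendant_def)
        moreover have "u \<noteq> y \<or> v \<noteq> z" "u \<noteq> z \<or> v \<noteq> y" using True uv by (auto simp: incomp_def)
        moreover have "u \<in> insert z P" "v \<in> insert z P" using uv(1) r'_D(4) by auto
        moreover have "w = z" if "(w, z) \<in> r'" "(z, w) \<in> r'" for w
          using that r'_D(3) by (auto dest: antisymD)
        ultimately have "u \<in> P" "v \<in> P" using uv cmp[of u] cmp[of v] r'(2) by blast+
        then show ?thesis using uv r'(2) by blast
      qed
      ultimately have "\<not> unique_split P (Restr r' P)" by (rule ref)
      then show False using u by (simp add: unique_split_Restr unique_split_pendant[OF pend])
    next
      case False
      then have cmp': "\<not> incomp r' x z \<and> \<not> incomp r' z x" if "x \<in> insert z P" for x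
        using that cmp r'(2) zz by (auto simp: incomp_def)
      obtain S where S: "S \<in> splits P r'"
        using uniq splits_mono[of r r' P] r'(2) by (auto simp: unique_split_def)
      then have SP: "S \<subseteq> P" by (rule splits_subset)
      \<comment> \<open>\<open>z\<close> is now comparable to everything, so it may be placed on
        either side of the split \<open>S\<close> of \<open>P\<close>.\<close>
      have "S \<in> splits (insert z P) r'" "insert z S \<in> splits (insert z P) r'"
        using S cmp' z' unfolding splits_iff by blast+
      \<comment> \<open>The two splits differ in \<open>z\<close>, so uniqueness makes them
        complementary, yet both treat \<open>y\<close> alike.\<close>
      then have "insert z S = S \<or> insert z S = insert z P - S" using unique_splitD[OF u] by blast
      then have "insert z S = insert z P - S" using SP z' by auto
      then have "y \<in> S \<longleftrightarrow> y \<notin> S" using z' by auto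
      then show False by simp
    qed
  qed
  then show ?thesis using fin po uniq unique_split_pendant[OF z] by (auto simp: two_chain_iff)
qed

lemma two_chain_card_le_1:
  assumes "finite P" "card P \<le> 1" "partial_order_on P r"
  shows "two_chain P r"
proof -
  have eq: "x = y" if "x \<in> P" "y \<in> P" for x y
    using that assms(1,2) by (auto simp: card_le_Suc0_iff_eq)
  have refl: "(x, x) \<in> r" if "x \<in> P" for x
    using that partial_order_onD(1)[OF assms(3)] by (auto simp: refl_on_def)
  have "{} \<in> splits P r" by (rule splitsI) (use eq refl in \<open>auto simp: incomp_def\<close>)
  moreover have "T = {} \<or> T = P - {}" if "T \<in> splits P r" for T
    using splits_subset[OF that] eq by blast
  ultimately have "unique_split P r" unfolding unique_split_def by blast
  moreover have "r' \<subseteq> r" if "partial_order_on P r'" for r'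
    using eq refl partial_order_onD(4)[OF that] by blast
  ultimately show ?thesis using assms by (auto simp: two_chain_iff)
qed

section \<open>Squares in the incomparability graph\<close>

text \<open>The 4-cycle runs through \<open>a\<close>, \<open>b\<close>, \<open>a'\<close>,
  \<open>b'\<close>; its diagonals are the two comparable pairs.\<close>

definition has_square :: "'a set \<Rightarrow> 'a rel \<Rightarrow> bool" where
  "has_square P r \<longleftrightarrow> (\<exists>a\<in>P. \<exists>a'\<in>P. \<exists>b\<in>P. \<exists>b'\<in>P. a \<noteq> a' \<and> b \<noteq> b' \<and> (a, a') \<in> r \<and> (b, b') \<in> r \<and>
     incomp r a b \<and> incomp r a b' \<and> incomp r a' b \<and> incomp r a' b')"

lemma poset_isomorphic_has_square:
  assumes "poset_isomorphic P r Q s" "has_square P r"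
  shows "has_square Q s"
proof -
  obtain f where f: "bij_betw f P Q" and iso: "\<And>x y. x \<in> P \<Longrightarrow> y \<in> P \<Longrightarrow> (x, y) \<in> r \<longleftrightarrow> (f x, f y) \<in> s"
    using assms(1) by (auto simp: poset_isomorphic_def)
  obtain a a' b b' where "a\<in>P" "a'\<in>P" "b\<in>P" "b'\<in>P" "a \<noteq> a'" "b \<noteq> b'" "(a, a') \<in> r" "(b, b') \<in> r"
     "incomp r a b" "incomp r a b'" "incomp r a' b" "incomp r a' b'"
    using assms(2) by (auto simp: has_square_def)
  then show ?thesis using f unfolding has_square_def
    by (intro bexI[of _ "f a"] bexI[of _ "f a'"] bexI[of _ "f b"] bexI[of _ "f b'"])
      (auto simp: iso incomp_def bij_betw_def inj_on_def)
qed

lemma has_square_mono: "P \<subseteq> Q \<Longrightarrow> has_square P r \<Longrightarrow> has_square Q r"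
  unfolding has_square_def by blast

text \<open>Among all squares over fixed \<open>a'\<close> and \<open>b\<close>, one with \<open>a\<close> as low and \<open>b'\<close> as high as
  possible allows the relation \<open>a < b'\<close> to be added, and the three remaining sides of the
  square still determine the decomposition.\<close>

lemma two_chain_no_square_aux:
  assumes tc: "two_chain P r" and mem: "a \<in> P" "a' \<in> P" "b \<in> P" "b' \<in> P"
    and ne: "a \<noteq> a'" "b \<noteq> b'" and le: "(a, a') \<in> r" "(b, b') \<in> r"
    and inc: "incomp r a b" "incomp r a b'" "incomp r a' b" "incomp r a' b'"
  shows False
  using mem ne le inc
\<comment> \<open>The measure shrinks when \<open>a\<close> moves down or \<open>b'\<close> moves
  up.\<close>
proof (induction "card {x \<in> P. (x, a) \<in> r} + card {y \<in> P. (b', y) \<in> r}" arbitrary: a b' rule: less_induct)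
  case less
  have fin: "finite P" and po: "partial_order_on P r" and uniq: "unique_split P r"
    and ref: "\<And>r'. partial_order_on P r' \<Longrightarrow> r \<subset> r' \<Longrightarrow> \<not> unique_split P r'"
    using tc by (auto simp: two_chain_iff)
  have rP: "r \<subseteq> P \<times> P" and refl: "\<And>x. x \<in> P \<Longrightarrow> (x, x) \<in> r"
    and tr: "\<And>x y z. (x, y) \<in> r \<Longrightarrow> (y, z) \<in> r \<Longrightarrow> (x, z) \<in> r"
    and as: "\<And>x y. (x, y) \<in> r \<Longrightarrow> (y, x) \<in> r \<Longrightarrow> x = y"
    using partial_order_onD[OF po] by (auto simp: refl_on_def dest: transD antisymD)
  note prems = less.prems
  \<comment> \<open>An \<open>x\<close> below \<open>a\<close> cannot lie above \<open>b'\<close>,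
    so it is either incomparable to \<open>b'\<close>, giving a smaller square, or below
    \<open>b'\<close>. Elements above \<open>b'\<close> are treated dually.\<close>
  consider (low) x where "(x, a) \<in> r" "x \<noteq> a" "incomp r x b'"
    | (high) y where "(b', y) \<in> r" "y \<noteq> b'" "incomp r a y"
    | (corner) "\<And>x. (x, a) \<in> r \<Longrightarrow> x \<noteq> a \<Longrightarrow> (x, b') \<in> r" "\<And>y. (b', y) \<in> r \<Longrightarrow> y \<noteq> b' \<Longrightarrow> (a, y) \<in> r"
    using prems tr unfolding incomp_def by metis
  then show False
  proof cases
    case low
    have xP: "x \<in> P" using low rP by auto
    have "{u \<in> P. (u, x) \<in> r} \<subset> {u \<in> P. (u, a) \<in> r}"
    proof
      show "{u \<in> P. (u, x) \<in> r} \<subseteq> {u \<in> P. (u, a) \<in> r}" using low tr by auto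
      have "a \<in> {u \<in> P. (u, a) \<in> r}" "a \<notin> {u \<in> P. (u, x) \<in> r}" using low prems refl as by auto
      then show "{u \<in> P. (u, x) \<in> r} \<noteq> {u \<in> P. (u, a) \<in> r}" by blast
    qed
    then have "card {u \<in> P. (u, x) \<in> r} < card {u \<in> P. (u, a) \<in> r}"
      using fin by (intro psubset_card_mono) auto
    moreover have "incomp r x b" using low prems tr unfolding incomp_def by blast
    moreover have "(x, a') \<in> r" "x \<noteq> a'" using low prems tr as by blast+
    ultimately show False using less.hyps[of x b'] low xP prems by simp
  next
    case high
    have yP: "y \<in> P" using high rP by auto
    have "{u \<in> P. (y, u) \<in> r} \<subset> {u \<in> P. (b', u) \<in> r}"
    proof
      show "{u \<in> P. (y, u) \<in> r} \<subseteq> {u \<in> P. (b', u) \<in> r}" using high tr by auto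
      have "b' \<in> {u \<in> P. (b', u) \<in> r}" "b' \<notin> {u \<in> P. (y, u) \<in> r}" using high prems refl as by auto
      then show "{u \<in> P. (y, u) \<in> r} \<noteq> {u \<in> P. (b', u) \<in> r}" by blast
    qed
    then have "card {u \<in> P. (y, u) \<in> r} < card {u \<in> P. (b', u) \<in> r}"
      using fin by (intro psubset_card_mono) auto
    moreover have "incomp r a' y" using high prems tr unfolding incomp_def by blast
    moreover have "(b, y) \<in> r" "b \<noteq> y" using high prems tr as by blast+
    ultimately show False using less.hyps[of a y] high yP prems by simp
  next
    case corner
    define r' where "r' = insert (a, b') r"
    \<comment> \<open>The \<open>corner\<close> conditions supply every pair that transitivity
      demands after adding \<open>(a, b')\<close>.\<close>
    have trans: "(x, z) \<in> r'" if "(x, y) \<in> r'" "(y, z) \<in> r'" for x y z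
      using that prems corner tr as unfolding r'_def incomp_def by (smt (verit) insert_iff prod.inject)
    have "partial_order_on P r'"
      unfolding partial_order_on_def preorder_on_def
    proof (intro conjI)
      show "r' \<subseteq> P \<times> P" using rP prems by (auto simp: r'_def)
      show "refl_on P r'" using refl by (auto simp: r'_def refl_on_def)
      show "trans r'" using trans by (auto intro: transI)
      have "(b', a) \<notin> r" using prems by (simp add: incomp_def)
      then show "antisym r'" using as unfolding antisym_def r'_def by blast
    qed
    moreover have "r \<subset> r'" using prems by (auto simp: r'_def incomp_def)
    moreover have "splits P r' = splits P r"
    proof
      show "splits P r \<subseteq> splits P r'" by (rule splits_mono) (auto simp: r'_def)
      show "splits P r' \<subseteq> splits P r"
      proof
        fix S assume S: "S \<in> splits P r'"
        \<comment> \<open>The path \<open>a\<close>, \<open>b\<close>, \<open>a'\<close>,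
          \<open>b'\<close> survives in \<open>r'\<close>; having three edges, it gives its ends
          opposite colours.\<close>
        have "incomp r' a b" "incomp r' a' b" "incomp r' a' b'" using prems by (auto simp: r'_def incomp_def)
        then have "a \<in> S \<longleftrightarrow> b' \<notin> S" using splits_incomp[OF S] prems by blast
        moreover have "incomp r' x y \<or> x = a \<and> y = b' \<or> x = b' \<and> y = a" if "incomp r x y" for x y
          using that by (auto simp: r'_def incomp_def)
        ultimately have "x \<in> S \<longleftrightarrow> y \<notin> S" if "x \<in> P" "y \<in> P" "incomp r x y" for x y
          using that splits_incomp[OF S] by blast
        then show "S \<in> splits P r" using splits_subset[OF S] by (simp add: splits_iff)
      qed
    qed
    ultimately show False using ref uniq unfolding unique_split_def by metis
  qed
qed

lemma two_chain_no_square: "two_chain P r \<Longrightarrow> \<not> has_square P r"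
  unfolding has_square_def using two_chain_no_square_aux by metis

section \<open>Permutation posets\<close>

text \<open>The value at \<open>x\<close> is the number of elements weakly below it, which depends
  on the order alone.\<close>

lemma rank_unique:
  fixes f g :: "'a \<Rightarrow> nat"
  assumes f: "bij_betw f P {1..n}" and g: "bij_betw g P {1..n}"
    and le: "\<And>x y. x \<in> P \<Longrightarrow> y \<in> P \<Longrightarrow> f x \<le> f y \<longleftrightarrow> g x \<le> g y"
    and x: "x \<in> P"
  shows "f x = g x"
proof -
  have rank: "card {y \<in> P. h y \<le> h x} = h x" if h: "bij_betw h P {1..n}" for h :: "'a \<Rightarrow> nat"
  proof -
    have img: "h ` P = {1..n}" and inj: "inj_on h P" using h by (auto simp: bij_betw_def)
    have "h x \<in> {1..n}" using img x by blast
    have "h ` {y \<in> P. h y \<le> h x} = {k \<in> h ` P. k \<le> h x}" by blast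
    also have "\<dots> = {1..h x}" using \<open>h x \<in> {1..n}\<close> unfolding img by auto
    finally have "card (h ` {y \<in> P. h y \<le> h x}) = h x" by simp
    moreover have "inj_on h {y \<in> P. h y \<le> h x}" using inj by (rule inj_on_subset) auto
    ultimately show ?thesis by (simp add: card_image)
  qed
  have "{y \<in> P. f y \<le> f x} = {y \<in> P. g y \<le> g x}" using le x by blast
  then show ?thesis using rank[OF f] rank[OF g] by simp
qed

lemma linear_order_rank:
  assumes fin: "finite P" and refl: "\<And>x. x \<in> P \<Longrightarrow> R x x"
    and trans: "\<And>x y z. x \<in> P \<Longrightarrow> y \<in> P \<Longrightarrow> z \<in> P \<Longrightarrow> R x y \<Longrightarrow> R y z \<Longrightarrow> R x z"
    and antisym: "\<And>x y. x \<in> P \<Longrightarrow> y \<in> P \<Longrightarrow> R x y \<Longrightarrow> R y x \<Longrightarrow> x = y"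
    and total: "\<And>x y. x \<in> P \<Longrightarrow> y \<in> P \<Longrightarrow> R x y \<or> R y x"
  obtains f :: "'a \<Rightarrow> nat" where "bij_betw f P {1..card P}"
    "\<And>x y. x \<in> P \<Longrightarrow> y \<in> P \<Longrightarrow> R x y \<longleftrightarrow> f x \<le> f y"
proof -
  define D where "D x = {y \<in> P. R y x}" for x
  \<comment> \<open>The count includes \<open>x\<close> itself, so ranks start at 1.\<close>
  define f where "f x = card (D x)" for x
  have finD: "finite (D x)" for x using fin by (simp add: D_def)
  have mono: "f x \<le> f y" if "x \<in> P" "y \<in> P" "R x y" for x y
    unfolding f_def
  proof (rule card_mono[OF finD])
    show "D x \<subseteq> D y" using that trans unfolding D_def by blast
  qed
  have strict: "f x < f y" if "x \<in> P" "y \<in> P" "R x y" "x \<noteq> y" for x y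
    unfolding f_def
  proof (rule psubset_card_mono[OF finD])
    have "D x \<subseteq> D y" using that trans unfolding D_def by blast
    moreover have "y \<in> D y" "y \<notin> D x" using that refl antisym unfolding D_def by blast+
    ultimately show "D x \<subset> D y" by blast
  qed
  have iff: "R x y \<longleftrightarrow> f x \<le> f y" if "x \<in> P" "y \<in> P" for x y
    using that mono strict[of y x] total[of x y] refl[of x] by (cases "x = y") fastforce+
  have inj: "inj_on f P"
    using strict total by (intro inj_onI) (metis less_irrefl)
  have "f ` P \<subseteq> {1..card P}"
  proof
    fix k assume "k \<in> f ` P"
    then obtain x where x: "x \<in> P" "k = f x" by blast
    then have "x \<in> D x" using refl by (simp add: D_def)
    then have "0 < f x" unfolding f_def using finD card_gt_0_iff by blast
    moreover have "f x \<le> card P" unfolding f_def by (rule card_mono[OF fin]) (auto simp: D_def)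
    ultimately show "k \<in> {1..card P}" using x by simp
  qed
  then have "f ` P = {1..card P}"
    by (intro card_subset_eq) (simp_all add: card_image[OF inj])
  then show ?thesis using that[of f] inj iff by (simp add: bij_betw_def)
qed

lemma perm_order_iff:
  "(i, j) \<in> perm_order n w \<longleftrightarrow> i \<in> {1..n} \<and> j \<in> {1..n} \<and> i \<le> j \<and> w i \<le> w j"
  by (simp add: perm_order_def)

lemma perm_order_subset: "perm_order n w \<subseteq> {1..n} \<times> {1..n}"
  by (auto simp: perm_order_def)

lemma partial_order_perm_order: "partial_order_on {1..n} (perm_order n w)"
  unfolding partial_order_on_def preorder_on_def
  by (auto simp: perm_order_def refl_on_def antisym_def intro!: transI)

lemma incomp_perm_order:
  assumes "w permutes {1..n}" "i \<in> {1..n}" "j \<in> {1..n}"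
  shows "incomp (perm_order n w) i j \<longleftrightarrow> i < j \<and> w j < w i \<or> j < i \<and> w i < w j"
proof -
  have "w i = w j \<longleftrightarrow> i = j" using permutes_inj[OF assms(1)] by (auto dest: injD)
  then show ?thesis using assms(2,3) by (auto simp: incomp_def perm_order_iff)
qed

text \<open>The order records which of any two positions carries the larger value; this fixes the
  ranks of the values, hence the values.\<close>

lemma perm_order_inject:
  assumes v: "v permutes {1..n}" and w: "w permutes {1..n}"
    and eq: "perm_order n v = perm_order n w"
  shows "v = w"
proof
  fix x
  have le: "v i \<le> v j \<longleftrightarrow> w i \<le> w j" if "i \<in> {1..n}" "j \<in> {1..n}" for i j
  proof -
    have "v i = v j \<longleftrightarrow> i = j" "w i = w j \<longleftrightarrow> i = j"
      using permutes_inj[OF v] permutes_inj[OF w] by (auto dest: injD)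
    moreover have "i \<le> j \<Longrightarrow> v i \<le> v j \<longleftrightarrow> w i \<le> w j" "j \<le> i \<Longrightarrow> v j \<le> v i \<longleftrightarrow> w j \<le> w i"
      using that eq perm_order_iff[of i j n] perm_order_iff[of j i n] by blast+
    ultimately show ?thesis by linarith
  qed
  show "v x = w x"
  proof (cases "x \<in> {1..n}")
    case True
    then show ?thesis
      using rank_unique[of v "{1..n}" n w x] permutes_imp_bij[OF v] permutes_imp_bij[OF w] le by blast
  next
    case False
    then show ?thesis using permutes_not_in[OF v] permutes_not_in[OF w] by simp
  qed
qed

text \<open>\<open>w\<close> itself is the isomorphism: it exchanges the roles of positions and
  values.\<close>

lemma perm_order_inv_iso:
  assumes w: "w permutes {1..n}"
  shows "poset_isomorphic {1..n} (perm_order n w) {1..n} (perm_order n (inv w))"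
  unfolding poset_isomorphic_def
  using permutes_imp_bij[OF w] permutes_in_image[OF w] permutes_inverses(2)[OF w]
  by (intro exI[of _ w]) (auto simp: perm_order_iff)

text \<open>A poset covered by two chains is the intersection of two linear extensions, obtained by
  directing all incomparable pairs from one chain to the other, respectively back.\<close>

lemma ex_perm_order_iso:
  assumes fin: "finite P" and po: "partial_order_on P r" and S: "S \<in> splits P r"
  shows "\<exists>w. w permutes {1..card P} \<and> poset_isomorphic P r {1..card P} (perm_order (card P) w)"
proof -
  have refl: "\<And>x. x \<in> P \<Longrightarrow> (x, x) \<in> r"
    and tr: "\<And>x y z. (x, y) \<in> r \<Longrightarrow> (y, z) \<in> r \<Longrightarrow> (x, z) \<in> r"
    and as: "\<And>x y. (x, y) \<in> r \<Longrightarrow> (y, x) \<in> r \<Longrightarrow> x = y"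
    using partial_order_onD[OF po] by (auto simp: refl_on_def dest: transD antisymD)
  \<comment> \<open>For a split \<open>A\<close>, this directs each incomparable pair from
    \<open>A\<close> to its complement.\<close>
  define R where "R A x y \<longleftrightarrow> (x, y) \<in> r \<or> incomp r x y \<and> x \<in> A" for A x y
  have ex: "\<exists>f :: 'a \<Rightarrow> nat. bij_betw f P {1..card P} \<and> (\<forall>x\<in>P. \<forall>y\<in>P. R A x y \<longleftrightarrow> f x \<le> f y)"
    if A: "A \<in> splits P r" for A
  proof -
    note A' = splits_incomp[OF A]
    show ?thesis
    proof (rule linear_order_rank[OF fin, of "R A"])
      show "R A x x" if "x \<in> P" for x using that refl by (simp add: R_def)
      \<comment> \<open>Two directed incomparable steps cannot follow each other, since the middle
        element would lie both inside and outside \<open>A\<close>.\<close>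
      show "R A x z" if "x \<in> P" "y \<in> P" "z \<in> P" "R A x y" "R A y z" for x y z
        using that A'[of x y] A'[of y z] A'[of x z] tr unfolding R_def incomp_def by blast
      show "x = y" if "x \<in> P" "y \<in> P" "R A x y" "R A y x" for x y
        using that A'[of x y] as unfolding R_def incomp_def by blast
      show "R A x y \<or> R A y x" if "x \<in> P" "y \<in> P" for x y
        using that A'[of x y] unfolding R_def incomp_def by blast
      show ?thesis if "bij_betw f P {1..card P}"
        "\<And>x y. x \<in> P \<Longrightarrow> y \<in> P \<Longrightarrow> R A x y \<longleftrightarrow> f x \<le> f y" for f :: "'a \<Rightarrow> nat"
        using that by blast
    qed
  qed
  obtain f :: "'a \<Rightarrow> nat" where f: "bij_betw f P {1..card P}"
      "\<forall>x\<in>P. \<forall>y\<in>P. R S x y \<longleftrightarrow> f x \<le> f y"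
    using ex[OF S] by (elim exE conjE)
  obtain g :: "'a \<Rightarrow> nat" where g: "bij_betw g P {1..card P}"
      "\<forall>x\<in>P. \<forall>y\<in>P. R (P - S) x y \<longleftrightarrow> g x \<le> g y"
    using ex[OF splits_compl[OF S]] by (elim exE conjE)
  \<comment> \<open>\<open>w\<close> sends the position of an element in the first extension to its
    position in the second.\<close>
  define w where "w i = (if i \<in> {1..card P} then g (inv_into P f i) else i)" for i
  have wf: "w (f x) = g x" if "x \<in> P" for x
  proof -
    have "f x \<in> {1..card P}" using f(1) that by (rule bij_betw_apply)
    then show ?thesis using bij_betw_inv_into_left[OF f(1) that] by (simp add: w_def)
  qed
  have "bij_betw w {1..card P} {1..card P}"
  proof -
    have "bij_betw (g \<circ> inv_into P f) {1..card P} {1..card P}"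
      using bij_betw_inv_into[OF f(1)] g(1) by (rule bij_betw_trans)
    then show ?thesis by (rule bij_betw_cong[THEN iffD1, rotated]) (simp add: w_def)
  qed
  then have "w permutes {1..card P}" by (rule bij_imp_permutes) (auto simp: w_def)
  moreover have "(x, y) \<in> r \<longleftrightarrow> (f x, f y) \<in> perm_order (card P) w" if "x \<in> P" "y \<in> P" for x y
  proof -
    have "(x, y) \<in> r \<longleftrightarrow> R S x y \<and> R (P - S) x y"
      by (auto simp: R_def incomp_def)
    moreover have "f x \<in> {1..card P}" "f y \<in> {1..card P}"
      using bij_betw_apply[OF f(1)] that by blast+
    moreover have "R S x y \<longleftrightarrow> f x \<le> f y" "R (P - S) x y \<longleftrightarrow> g x \<le> g y"
      using f(2) g(2) that by blast+
    ultimately show ?thesis using that by (simp add: perm_order_iff wf)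
  qed
  ultimately show ?thesis using f(1) unfolding poset_isomorphic_def by blast
qed

section \<open>Isomorphisms between permutation posets\<close>

text \<open>\<open>?A\<close> consists of the left-to-right maxima. The existence of a split rules
  out decreasing triples, so the left end of an inversion is such a maximum, while the right end
  never is.\<close>

lemma left_to_right_maxima_split:
  assumes w: "w permutes {1..n}" and S: "S \<in> splits {1..n} (perm_order n w)"
  shows "{j \<in> {1..n}. \<forall>i\<in>{1..n}. i < j \<longrightarrow> w i < w j} \<in> splits {1..n} (perm_order n w)"
    (is "?A \<in> _")
proof (rule splitsI)
  note inc = incomp_perm_order[OF w]
  have wlog: "i \<in> ?A \<and> j \<notin> ?A" if ij: "i \<in> {1..n}" "j \<in> {1..n}" "i < j" "w j < w i" for i j
  proof
    show "j \<notin> ?A" using ij by force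
    show "i \<in> ?A"
    proof (rule ccontr)
      assume "i \<notin> ?A"
      then obtain k where k: "k \<in> {1..n}" "k < i" "\<not> w k < w i" using ij by auto
      moreover have "w k \<noteq> w i" using k permutes_inj[OF w] by (auto dest: injD)
      ultimately have "w i < w k" by simp
      \<comment> \<open>\<open>k\<close>, \<open>i\<close>, \<open>j\<close> would be pairwise
        incomparable, and a triangle has no 2-colouring.\<close>
      then show False
        using k ij splits_incomp[OF S, of i j] splits_incomp[OF S, of i k] splits_incomp[OF S, of k j]
        by (auto simp: inc)
    qed
  qed
  show "i \<in> ?A \<longleftrightarrow> j \<notin> ?A" if "i \<in> {1..n}" "j \<in> {1..n}" "incomp (perm_order n w) i j" for i j
    using that wlog[of i j] wlog[of j i] unfolding inc[OF that(1,2)] by blast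
qed auto

text \<open>By uniqueness, an isomorphism carries the left-to-right maxima of \<open>v\<close> to
  those of \<open>w\<close> or to their complement. In the first case it preserves positions, so it
  is the identity; in the second its composition with \<open>w\<close> is increasing, so it is
  \<open>inv w\<close>.\<close>

lemma perm_order_iso_imp:
  assumes v: "v permutes {1..n}" and w: "w permutes {1..n}"
    and uniq: "unique_split {1..n} (perm_order n w)"
    and iso: "poset_isomorphic {1..n} (perm_order n v) {1..n} (perm_order n w)"
  shows "v = w \<or> v = inv w"
proof -
  let ?N = "{1..n}"
  define A where "A u = {j \<in> ?N. \<forall>i\<in>?N. i < j \<longrightarrow> u i < u j}" for u :: "nat \<Rightarrow> nat"
  obtain f where f: "bij_betw f ?N ?N"
    and f_iff: "\<And>i j. i \<in> ?N \<Longrightarrow> j \<in> ?N \<Longrightarrow> (i, j) \<in> perm_order n v \<longleftrightarrow> (f i, f j) \<in> perm_order n w"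
    using iso unfolding poset_isomorphic_def by blast
  have fN: "f i \<in> ?N" if "i \<in> ?N" for i using f that by (rule bij_betw_apply)
  have f_inj: "f i = f j \<longleftrightarrow> i = j" if "i \<in> ?N" "j \<in> ?N" for i j
    using f that by (auto simp: bij_betw_def dest: inj_onD)
  have f_inc: "incomp (perm_order n v) i j \<longleftrightarrow> incomp (perm_order n w) (f i) (f j)"
    if "i \<in> ?N" "j \<in> ?N" for i j
    using f_iff[of i j] f_iff[of j i] that by (simp add: incomp_def)
  obtain S where S: "S \<in> splits ?N (perm_order n w)" using uniq by (auto simp: unique_split_def)
  have Aw: "A w \<in> splits ?N (perm_order n w)"
    unfolding A_def by (rule left_to_right_maxima_split[OF w S])
  have "unique_split ?N (perm_order n v)"
    by (rule poset_isomorphic_unique_split[OF poset_isomorphic_sym[OF iso] uniq])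
  then obtain T where "T \<in> splits ?N (perm_order n v)" by (auto simp: unique_split_def)
  then have Av: "A v \<in> splits ?N (perm_order n v)"
    unfolding A_def by (rule left_to_right_maxima_split[OF v])
  have fA: "f ` A v \<in> splits ?N (perm_order n w)"
    using splits_iso[OF f f_iff splits_subset[OF Av]] Av by simp
  \<comment> \<open>The next two facts translate membership: of two incomparable positions, the one
    in \<open>A u\<close> is the left one and carries the larger value.\<close>
  have f_mem: "f i \<in> f ` A v \<longleftrightarrow> i \<in> A v" if "i \<in> ?N" for i
    using f_inj that splits_subset[OF Av] by blast
  have order_A: "i < j \<longleftrightarrow> i \<in> A u" "u j < u i \<longleftrightarrow> i \<in> A u"
    if "u permutes ?N" "A u \<in> splits ?N (perm_order n u)" "i \<in> ?N" "j \<in> ?N"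
      "incomp (perm_order n u) i j" for u i j
  proof -
    have "i \<in> A u \<longleftrightarrow> j \<notin> A u" using splits_incomp[OF that(2-5)] .
    moreover have "i < j \<and> u j < u i \<or> j < i \<and> u i < u j"
      using incomp_perm_order[OF that(1,3,4)] that(5) by simp
    moreover have "j \<notin> A u" if "i < j" "u j < u i"
      using that \<open>i \<in> ?N\<close> unfolding A_def by force
    moreover have "i \<notin> A u" if "j < i" "u i < u j"
      using that \<open>j \<in> ?N\<close> unfolding A_def by force
    ultimately show "i < j \<longleftrightarrow> i \<in> A u" "u j < u i \<longleftrightarrow> i \<in> A u" by auto
  qed
  note bij_id = bij_betw_id[of ?N]
  consider "f ` A v = A w" | "f ` A v = ?N - A w" using unique_splitD[OF uniq Aw fA] by blast
  then show ?thesis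
  proof cases
    case 1
    have lt: "f i < f j" if ij: "i \<in> ?N" "j \<in> ?N" "i < j" for i j
    proof (cases "incomp (perm_order n v) i j")
      case True
      then have "i \<in> A v" using order_A(1)[OF v Av ij(1,2)] ij by simp
      then have "f i \<in> A w" using f_mem[OF ij(1)] 1 by simp
      then show ?thesis
        using order_A(1)[OF w Aw fN fN] f_inc True ij by blast
    next
      case False
      then have "(i, j) \<in> perm_order n v" using ij by (auto simp: incomp_def perm_order_iff)
      then have "f i \<le> f j" using f_iff[OF ij(1,2)] unfolding perm_order_iff by blast
      then show ?thesis using f_inj[OF ij(1,2)] ij(3) by simp
    qed
    \<comment> \<open>An increasing bijection of \<open>?N\<close> is the identity.\<close>
    have "f i = id i" if "i \<in> ?N" for i
    proof (rule rank_unique[OF f bij_id _ that])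
      show "f i \<le> f j \<longleftrightarrow> id i \<le> id j" if "i \<in> ?N" "j \<in> ?N" for i j
        using lt[of i j] lt[of j i] f_inj[of i j] that by (simp add: linorder_not_less[symmetric]) force
    qed
    then have "perm_order n v = perm_order n w"
      using f_iff perm_order_subset[of n v] perm_order_subset[of n w] by auto
    then show ?thesis using perm_order_inject[OF v w] by blast
  next
    case 2
    have wf: "w (f i) = w (f j) \<longleftrightarrow> i = j" if "i \<in> ?N" "j \<in> ?N" for i j
      using f_inj[OF that] permutes_inj[OF w] by (auto dest: injD)
    have lt: "w (f i) < w (f j)" if ij: "i \<in> ?N" "j \<in> ?N" "i < j" for i j
    proof (cases "incomp (perm_order n v) i j")
      case True
      then have "i \<in> A v" using order_A(1)[OF v Av ij(1,2)] ij by simp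
      \<comment> \<open>Complementation sends the left position of the pair to the one with the
        smaller value under \<open>w\<close>.\<close>
      then have "f i \<notin> A w" using f_mem[OF ij(1)] 2 by auto
      then have "\<not> w (f j) < w (f i)"
        using order_A(2)[OF w Aw fN fN] f_inc True ij by blast
      then show ?thesis using wf[OF ij(1,2)] ij(3) by simp
    next
      case False
      then have "(i, j) \<in> perm_order n v" using ij by (auto simp: incomp_def perm_order_iff)
      then have "w (f i) \<le> w (f j)" using f_iff[OF ij(1,2)] unfolding perm_order_iff by blast
      then show ?thesis using wf[OF ij(1,2)] ij(3) by simp
    qed
    have bij: "bij_betw (w \<circ> f) ?N ?N"
      using f permutes_imp_bij[OF w] by (rule bij_betw_trans)
    have wf_id: "(w \<circ> f) i = id i" if "i \<in> ?N" for i
    proof (rule rank_unique[OF bij bij_id _ that])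
      show "(w \<circ> f) i \<le> (w \<circ> f) j \<longleftrightarrow> id i \<le> id j" if "i \<in> ?N" "j \<in> ?N" for i j
        using lt[of i j] lt[of j i] wf[of i j] that by (simp add: linorder_not_less[symmetric]) force
    qed
    then have f_eq: "f i = inv w i" if "i \<in> ?N" for i
      using that permutes_inverses(2)[OF w, of "f i"] by simp
    have "(i, j) \<in> perm_order n v \<longleftrightarrow> (i, j) \<in> perm_order n (inv w)" if "i \<in> ?N" "j \<in> ?N" for i j
    proof -
      have "(i, j) \<in> perm_order n v \<longleftrightarrow> f i \<le> f j \<and> w (f i) \<le> w (f j)"
        using f_iff[OF that] fN that by (simp add: perm_order_iff)
      also have "\<dots> \<longleftrightarrow> (i, j) \<in> perm_order n (inv w)"
        using wf_id[OF that(1)] wf_id[OF that(2)] f_eq that by (auto simp: perm_order_iff)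
      finally show ?thesis .
    qed
    then have "perm_order n v = perm_order n (inv w)"
      using perm_order_subset[of n v] perm_order_subset[of n "inv w"] by auto
    then show ?thesis using perm_order_inject[OF v permutes_inv[OF w]] by blast
  qed
qed

section \<open>Coxeter elements\<close>

definition coxeter_prod :: "nat list \<Rightarrow> nat \<Rightarrow> nat" where
  "coxeter_prod xs = foldr (\<circ>) (map coxeter_gen xs) id"

lemma coxeter_prod_simps [simp]:
  "coxeter_prod [] = id"
  "coxeter_prod (i # xs) = coxeter_gen i \<circ> coxeter_prod xs"
  by (simp_all add: coxeter_prod_def)

lemma coxeter_prod_append: "coxeter_prod (xs @ ys) = coxeter_prod xs \<circ> coxeter_prod ys"
  by (induction xs) (simp_all add: comp_assoc)

lemma coxeter_gen_involutory [simp]: "coxeter_gen i (coxeter_gen i x) = x"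
  by (simp add: coxeter_gen_def)

text \<open>Each generator is its own inverse, so a word cancels against its reversal.\<close>

lemma coxeter_prod_rev: "coxeter_prod (rev xs) = inv (coxeter_prod xs)"
proof -
  have inverse: "coxeter_prod (rev ys) (coxeter_prod ys x) = x" for ys x
    by (induction ys) (simp_all add: coxeter_prod_append)
  have *: "coxeter_prod (rev ys) \<circ> coxeter_prod ys = id" for ys
    by (rule ext) (simp add: inverse)
  show ?thesis using *[of xs] *[of "rev xs"] unfolding rev_rev_ident
    by (metis inv_unique_comp)
qed

lemma coxeter_element_iff:
  "coxeter_element n w \<longleftrightarrow> (\<exists>xs. distinct xs \<and> set xs = {1..<n} \<and> w = coxeter_prod xs)"
  by (simp add: coxeter_element_def coxeter_prod_def)

lemma coxeter_element_permutes:
  assumes "coxeter_element n w"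
  shows "w permutes {1..n}"
proof -
  have "coxeter_prod xs permutes {1..n}" if "set xs \<subseteq> {1..<n}" for xs
    using that
  proof (induction xs)
    case Nil
    show ?case unfolding coxeter_prod_simps by (rule permutes_id)
  next
    case (Cons i xs)
    have "coxeter_gen i permutes {1..n}"
      unfolding coxeter_gen_def using Cons.prems by (intro permutes_swap_id) auto
    moreover have "coxeter_prod xs permutes {1..n}" using Cons by simp
    ultimately show ?case unfolding coxeter_prod_simps by (rule permutes_compose[rotated])
  qed
  then show ?thesis using assms by (auto simp: coxeter_element_iff)
qed

lemma coxeter_element_inv:
  assumes "coxeter_element n w"
  shows "coxeter_element n (inv w)"
proof -
  obtain xs where "distinct xs" "set xs = {1..<n}" "w = coxeter_prod xs"
    using assms by (auto simp: coxeter_element_iff)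
  then show ?thesis
    unfolding coxeter_element_iff by (intro exI[of _ "rev xs"]) (simp add: coxeter_prod_rev)
qed

lemma coxeter_element_le_1: "n \<le> 1 \<Longrightarrow> coxeter_element n w \<longleftrightarrow> w = id"
  by (auto simp: coxeter_element_iff)

lemma coxeter_gen_commute: "i + 1 < k \<Longrightarrow> coxeter_gen i \<circ> coxeter_gen k = coxeter_gen k \<circ> coxeter_gen i"
  by (auto simp: coxeter_gen_def transpose_def fun_eq_iff)

lemma coxeter_prod_commute:
  "(\<And>i. i \<in> set xs \<Longrightarrow> i + 1 < k) \<Longrightarrow> coxeter_prod xs \<circ> coxeter_gen k = coxeter_gen k \<circ> coxeter_prod xs"
proof (induction xs)
  case (Cons i xs)
  have IH: "coxeter_prod xs \<circ> coxeter_gen k = coxeter_gen k \<circ> coxeter_prod xs"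
    by (rule Cons.IH) (use Cons.prems in simp)
  have "coxeter_prod (i # xs) \<circ> coxeter_gen k = coxeter_gen i \<circ> (coxeter_prod xs \<circ> coxeter_gen k)"
    by (simp add: comp_assoc)
  also have "\<dots> = (coxeter_gen i \<circ> coxeter_gen k) \<circ> coxeter_prod xs"
    unfolding IH by (simp only: comp_assoc)
  also have "\<dots> = coxeter_gen k \<circ> coxeter_prod (i # xs)"
    using coxeter_gen_commute[of i k] Cons.prems by (simp add: comp_assoc del: comp_apply)
  finally show ?case .
qed simp

lemma coxeter_element_comp_gen:
  assumes "n \<ge> 1" "coxeter_element n w"
  shows "coxeter_element (Suc n) (w \<circ> coxeter_gen n)"
proof -
  obtain xs where "distinct xs" "set xs = {1..<n}" "w = coxeter_prod xs"
    using assms by (auto simp: coxeter_element_iff)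
  then show ?thesis using assms(1)
    unfolding coxeter_element_iff by (intro exI[of _ "xs @ [n]"]) (auto simp: coxeter_prod_append)
qed

text \<open>The last generator commutes with every generator except its neighbour, which stands
  on one side of it only.\<close>

lemma coxeter_element_SucE:
  assumes n: "n \<ge> 1" and w: "coxeter_element (Suc n) w"
  obtains u where "coxeter_element n u" "w = u \<circ> coxeter_gen n \<or> inv w = inv u \<circ> coxeter_gen n"
proof -
  obtain zs where zs: "distinct zs" "set zs = {1..<Suc n}" "w = coxeter_prod zs"
    using w by (auto simp: coxeter_element_iff)
  have "n \<in> set zs" using zs(2) n by simp
  then obtain xs ys where xy: "zs = xs @ n # ys" by (auto dest: split_list)
  define u where "u = coxeter_prod (xs @ ys)"
  have dist: "distinct (xs @ ys)" "n \<notin> set (xs @ ys)" using zs(1) xy by auto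
  have set: "set (xs @ ys) = {1..<n}"
  proof -
    have "set (xs @ ys) = set zs - {n}" using dist xy by auto
    also have "\<dots> = {1..<n}" unfolding zs(2) by auto
    finally show ?thesis .
  qed
  have u: "coxeter_element n u" using dist(1) set unfolding coxeter_element_iff u_def by blast
  have w_eq: "w = coxeter_prod xs \<circ> coxeter_gen n \<circ> coxeter_prod ys"
    by (simp add: zs(3) xy coxeter_prod_append comp_assoc)
  \<comment> \<open>\<open>n - 1\<close> occurs at most once, so one side of \<open>n\<close> avoids
    it; for \<open>n = 1\<close> it is 0, which is no index at all.\<close>
  consider "n - 1 \<notin> set xs" | "n - 1 \<notin> set ys" using dist by auto
  then show ?thesis
  proof cases
    case 1
    then have "i + 1 < n" if "i \<in> set xs" for i
    proof -
      have "i < n" "i \<noteq> n - 1" using that set 1 by auto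
      then show ?thesis by simp
    qed
    then have "w = coxeter_gen n \<circ> u"
      by (simp add: w_eq u_def coxeter_prod_commute coxeter_prod_append comp_assoc)
    moreover have "bij u" "bij (coxeter_gen n)"
      using coxeter_element_permutes[OF u] by (auto simp: permutes_bij coxeter_gen_def)
    \<comment> \<open>Inversion moves the last generator to the right end, so both cases peel it off
      there.\<close>
    ultimately have "inv w = inv u \<circ> coxeter_gen n"
      by (simp add: o_inv_distrib coxeter_gen_def)
    then show ?thesis using that u by blast
  next
    case 2
    then have "i + 1 < n" if "i \<in> set ys" for i
    proof -
      have "i < n" "i \<noteq> n - 1" using that set 2 by auto
      then show ?thesis by simp
    qed
    then have "w = u \<circ> coxeter_gen n"
      by (simp add: w_eq u_def coxeter_prod_commute coxeter_prod_append comp_assoc)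
    then show ?thesis using that u by blast
  qed
qed

section \<open>Inserting the largest value\<close>

text \<open>Renumbers the positions after position \<open>n\<close> has been deleted.\<close>

definition skip :: "nat \<Rightarrow> nat \<Rightarrow> nat" where
  "skip n i = (if i = Suc n then n else i)"

context
  fixes n :: nat and u w :: "nat \<Rightarrow> nat"
  assumes n: "n \<ge> 1" and u: "u permutes {1..n}" and w_def: "w = u \<circ> coxeter_gen n"
begin

text \<open>In one-line notation, \<open>w\<close> is \<open>u\<close> with the value
  \<open>Suc n\<close> inserted just before the last entry.\<close>

lemma comp_gen_simps:
  "w n = Suc n" "w (Suc n) = u n" "i \<noteq> n \<Longrightarrow> i \<noteq> Suc n \<Longrightarrow> w i = u i"
  using permutes_not_in[OF u, of "Suc n"] by (auto simp: w_def coxeter_gen_def transpose_def)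

lemma insert_carrier: "insert n ({1..Suc n} - {n}) = {1..Suc n}"
  using n by auto

lemma comp_gen_permutes: "w permutes {1..Suc n}"
proof -
  have "coxeter_gen n permutes {1..Suc n}"
    unfolding coxeter_gen_def using n by (intro permutes_swap_id) auto
  moreover have "u permutes {1..Suc n}" using u by (rule permutes_subset) auto
  ultimately show ?thesis unfolding w_def by (rule permutes_compose)
qed

lemma comp_gen_le: "i \<in> {1..Suc n} \<Longrightarrow> w i \<le> Suc n"
  using permutes_in_image[OF comp_gen_permutes, of i] by simp

text \<open>Deleting the entry at position \<open>n\<close> of \<open>w\<close> leaves the one-line
  word of \<open>u\<close>.\<close>

lemma skip_iso:
  "poset_isomorphic ({1..Suc n} - {n}) (perm_order (Suc n) w) {1..n} (perm_order n u)"
  unfolding poset_isomorphic_def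
proof (intro exI conjI ballI)
  show "bij_betw (skip n) ({1..Suc n} - {n}) {1..n}"
    by (rule bij_betw_byWitness[where f' = "\<lambda>i. if i = n then Suc n else i"])
      (use n in \<open>auto simp: skip_def\<close>)
  show "(i, j) \<in> perm_order (Suc n) w \<longleftrightarrow> (skip n i, skip n j) \<in> perm_order n u"
    if "i \<in> {1..Suc n} - {n}" "j \<in> {1..Suc n} - {n}" for i j
    using that n comp_gen_simps by (auto simp: perm_order_iff skip_def)
qed

text \<open>The largest value forms inversions exactly with the entries to its right, and position
  \<open>n\<close> has just one of these.\<close>

lemma pendant_largest_value: "pendant (perm_order (Suc n) w) ({1..Suc n} - {n}) n (Suc n)"
  unfolding pendant_def
proof (intro conjI ballI)
  fix i assume i: "i \<in> {1..Suc n} - {n}"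
  have "i = Suc n \<longleftrightarrow> n < i" using i by auto
  moreover have "w i < w n"
  proof -
    have "w i \<noteq> w n" using i permutes_inj[OF comp_gen_permutes] by (auto dest: injD)
    then show ?thesis using comp_gen_le[of i] i by (simp add: comp_gen_simps(1))
  qed
  ultimately show "incomp (perm_order (Suc n) w) i n \<longleftrightarrow> i = Suc n"
    using incomp_perm_order[OF comp_gen_permutes, of i n] i n by auto
qed (use n in \<open>auto simp: perm_order_iff\<close>)

lemma two_chain_insert:
  assumes "two_chain {1..n} (perm_order n u)"
  shows "two_chain {1..Suc n} (perm_order (Suc n) w)"
proof -
  let ?P = "{1..Suc n} - {n}"
  have "poset_isomorphic ?P (Restr (perm_order (Suc n) w) ?P) {1..n} (perm_order n u)"
    using skip_iso by (simp add: poset_isomorphic_def)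
  then have "two_chain ?P (Restr (perm_order (Suc n) w) ?P)"
    by (rule two_chain_iso[OF poset_isomorphic_sym _ assms]) blast
  then show ?thesis
    using two_chain_pendant[OF pendant_largest_value] partial_order_perm_order[of "Suc n" w]
    unfolding insert_carrier by blast
qed

lemma unique_split_remove:
  assumes "unique_split {1..Suc n} (perm_order (Suc n) w)"
  shows "unique_split {1..n} (perm_order n u)"
  using assms unique_split_pendant[OF pendant_largest_value]
  unfolding insert_carrier by (intro poset_isomorphic_unique_split[OF skip_iso]) simp

text \<open>Used contrapositively, to pass the absence of squares from \<open>w\<close> down to
  \<open>u\<close>.\<close>

lemma has_square_insert:
  assumes "has_square {1..n} (perm_order n u)"
  shows "has_square {1..Suc n} (perm_order (Suc n) w)"
  by (rule has_square_mono[OF Diff_subset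
      poset_isomorphic_has_square[OF poset_isomorphic_sym[OF skip_iso] assms]])

end

section \<open>Coxeter elements versus 2-chains, by induction on \<open>n\<close>\<close>

text \<open>Peeling the last generator off \<open>w\<close> or \<open>inv w\<close> leaves a Coxeter
  element on fewer points, and attaching a leaf to its 2-chain gives the larger one. Inverses have
  isomorphic posets.\<close>

lemma coxeter_element_two_chain:
  "coxeter_element n w \<Longrightarrow> two_chain {1..n} (perm_order n w)"
proof (induction n arbitrary: w)
  case 0
  show ?case by (rule two_chain_card_le_1[OF _ _ partial_order_perm_order]) simp_all
next
  case (Suc n)
  show ?case
  \<comment> \<open>Passing from 0 to 1 points adds no generator, so there is nothing to peel
    off.\<close>
  proof (cases "n = 0")
    case True
    then show ?thesis by (intro two_chain_card_le_1[OF _ _ partial_order_perm_order]) simp_all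
  next
    case False
    then have n: "n \<ge> 1" by simp
    obtain u where u: "coxeter_element n u" "w = u \<circ> coxeter_gen n \<or> inv w = inv u \<circ> coxeter_gen n"
      using coxeter_element_SucE[OF n Suc.prems] .
    from u(2) show ?thesis
    proof
      assume "w = u \<circ> coxeter_gen n"
      then show ?thesis
        using two_chain_insert[OF n coxeter_element_permutes[OF u(1)]] Suc.IH[OF u(1)] by blast
    next
      assume w: "inv w = inv u \<circ> coxeter_gen n"
      have inv_u: "coxeter_element n (inv u)" using u(1) by (rule coxeter_element_inv)
      have "two_chain {1..Suc n} (perm_order (Suc n) (inv w))"
        using two_chain_insert[OF n coxeter_element_permutes[OF inv_u] w] Suc.IH[OF inv_u] by blast
      then show ?thesis
        using two_chain_iso[OF poset_isomorphic_sym[OF perm_order_inv_iso] perm_order_subset]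
          coxeter_element_permutes[OF Suc.prems] by blast
    qed
  qed
qed

text \<open>If both equations failed, the positions \<open>p < m\<close> of the values
  \<open>n\<close> and \<open>Suc n\<close> would precede the last two positions, whose values are
  smaller and increasing; these four form a square.\<close>

lemma largest_value_position:
  assumes n: "n \<ge> 1" and w: "w permutes {1..Suc n}"
    and uniq: "unique_split {1..Suc n} (perm_order (Suc n) w)"
    and sq: "\<not> has_square {1..Suc n} (perm_order (Suc n) w)"
  shows "w n = Suc n \<or> w (Suc n) = n"
proof (rule ccontr)
  assume contra: "\<not> (w n = Suc n \<or> w (Suc n) = n)"
  let ?N = "{1..Suc n}"
  let ?r = "perm_order (Suc n) w"
  note inc = incomp_perm_order[OF w]
  have w_eq: "w i = w j \<longleftrightarrow> i = j" for i j using permutes_inj[OF w] by (auto dest: injD)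
  have w_N: "w i \<in> ?N \<longleftrightarrow> i \<in> ?N" for i using permutes_in_image[OF w] .
  obtain S where S: "S \<in> splits ?N ?r" using uniq by (auto simp: unique_split_def)
  \<comment> \<open>Three pairwise incomparable elements cannot be 2-coloured.\<close>
  have no3: False if "i \<in> ?N" "j \<in> ?N" "k \<in> ?N" "i < j" "j < k" "w k < w j" "w j < w i" for i j k
    using that splits_incomp[OF S, of i j] splits_incomp[OF S, of j k] splits_incomp[OF S, of i k]
    by (auto simp: inc)
  \<comment> \<open>If \<open>w\<close> fixed \<open>Suc n\<close>, that element would be comparable
    to everything and could change sides.\<close>
  have top: "w (Suc n) \<noteq> Suc n"
  proof
    assume top: "w (Suc n) = Suc n"
    have "\<not> incomp ?r i (Suc n)" if "i \<in> ?N" for i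
    proof -
      have "w i \<le> Suc n" using w_N[of i] that by simp
      then show ?thesis using that inc[of i "Suc n"] top by auto
    qed
    then have cmp: "\<not> incomp ?r i (Suc n)" "\<not> incomp ?r (Suc n) i" if "i \<in> ?N" for i
      using that incomp_sym by metis+
    have "S - {Suc n} \<in> splits ?N ?r" "insert (Suc n) S \<in> splits ?N ?r"
      using splits_subset[OF S] splits_incomp[OF S] cmp by (intro splitsI; force)+
    then have "insert (Suc n) S = S - {Suc n} \<or> insert (Suc n) S = ?N - (S - {Suc n})"
      using unique_splitD[OF uniq] by blast
    then have "insert (Suc n) S = ?N - (S - {Suc n})" by blast
    \<comment> \<open>The element 1 differs from \<open>Suc n\<close> because
      \<open>n \<ge> 1\<close>, so moving \<open>Suc n\<close> does not affect its side.\<close>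
    then have "1 \<in> insert (Suc n) S \<longleftrightarrow> 1 \<in> ?N - (S - {Suc n})" by (rule arg_cong)
    then have "1 \<in> S \<longleftrightarrow> 1 \<notin> S" using n by simp
    then show False by simp
  qed
  define m p where "m = inv w (Suc n)" and "p = inv w n"
  have wm: "w m = Suc n" and wp: "w p = n"
    by (simp_all add: m_def p_def permutes_inverses(1)[OF w])
  have N: "n \<in> ?N" "Suc n \<in> ?N" "m \<in> ?N" "p \<in> ?N"
    using n w_N[of m] w_N[of p] wm wp by auto
  have "m \<noteq> Suc n" "m \<noteq> n" "p \<noteq> Suc n" "p \<noteq> m" using top contra wm wp by auto
  then have mn: "m < n" and p: "p < Suc n" using N by auto
  have lt_top: "w i < Suc n" if "i \<in> ?N" "i \<noteq> m" for i
    using that w_N[of i] w_eq[of i m] wm by auto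
  \<comment> \<open>Otherwise positions \<open>m\<close>, \<open>n\<close>, \<open>Suc n\<close>
    would carry a decreasing triple.\<close>
  have wn: "w n < w (Suc n)"
  proof (rule ccontr)
    assume "\<not> w n < w (Suc n)"
    then have "w (Suc n) < w n" using w_eq[of n "Suc n"] by linarith
    moreover have "w n < w m" using lt_top[of n] N(1) \<open>m \<noteq> n\<close> wm by simp
    ultimately show False by (rule no3[OF N(3,1,2) mn lessI])
  qed
  have ltn: "w (Suc n) < n"
    using lt_top[of "Suc n"] \<open>m \<noteq> Suc n\<close> contra N by auto
  \<comment> \<open>Otherwise positions \<open>m\<close>, \<open>p\<close>, \<open>Suc n\<close>
    would carry a decreasing triple.\<close>
  have "p < m"
  proof (rule ccontr)
    assume "\<not> p < m"
    then have "m < p" using \<open>p \<noteq> m\<close> by simp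
    moreover have "w (Suc n) < w p" "w p < w m" using ltn by (simp_all add: wp wm)
    ultimately show False using no3[OF N(3,4,2) _ p] by blast
  qed
  have "has_square ?N ?r"
    unfolding has_square_def
    by (intro bexI[of _ p] bexI[of _ m] bexI[of _ n] bexI[of _ "Suc n"])
      (use N \<open>p < m\<close> mn p wn ltn wm wp in \<open>auto simp: inc perm_order_iff\<close>)
  then show False using sq by contradiction
qed

text \<open>Up to inversion, the largest value sits at position \<open>n\<close>. Removing it
  preserves both hypotheses, so induction yields a Coxeter element to which the last generator is
  appended.\<close>

lemma coxeter_element_of_unique_split:
  "w permutes {1..n} \<Longrightarrow> unique_split {1..n} (perm_order n w) \<Longrightarrow>
    \<not> has_square {1..n} (perm_order n w) \<Longrightarrow> coxeter_element n w"
proof (induction n arbitrary: w)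
  case 0
  then have "w = id" by simp
  then show ?case by (rule coxeter_element_le_1[THEN iffD2, rotated]) simp
next
  case (Suc n)
  show ?case
  proof (cases "n = 0")
    case True
    then have "w = id" using Suc.prems(1) by (simp add: permutes_sing)
    then show ?thesis by (rule coxeter_element_le_1[THEN iffD2, rotated]) (simp add: True)
  next
    case False
    then have n: "n \<ge> 1" by simp
    have step: "coxeter_element (Suc n) v"
      if v: "v permutes {1..Suc n}" "unique_split {1..Suc n} (perm_order (Suc n) v)"
        "\<not> has_square {1..Suc n} (perm_order (Suc n) v)" "v n = Suc n" for v
    proof -
      define u where "u = v \<circ> coxeter_gen n"
      have gen: "coxeter_gen n permutes {1..Suc n}"
        unfolding coxeter_gen_def using n by (intro permutes_swap_id) auto
      have "u permutes {1..Suc n}" unfolding u_def by (rule permutes_compose[OF gen v(1)])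
      \<comment> \<open>Multiplying by the last generator moves the largest value to position
        \<open>Suc n\<close>, so \<open>u\<close> lives on \<open>{1..n}\<close>.\<close>
      moreover have "u (Suc n) = Suc n" using v(4) by (simp add: u_def coxeter_gen_def)
      ultimately have u: "u permutes {1..n}"
        by (auto intro: permutes_superset simp: le_Suc_eq)
      have vu: "v = u \<circ> coxeter_gen n" by (rule ext) (simp add: u_def)
      have "coxeter_element n u"
        using Suc.IH[OF u] unique_split_remove[OF n u vu] has_square_insert[OF n u vu] v by blast
      then show ?thesis unfolding vu by (rule coxeter_element_comp_gen[OF n])
    qed
    have "w n = Suc n \<or> w (Suc n) = n" by (rule largest_value_position[OF n Suc.prems])
    then show ?thesis
    proof
      assume "w n = Suc n"
      then show ?thesis using step Suc.prems by blast
    next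
      assume wn: "w (Suc n) = n"
      note perm = Suc.prems(1)
      note iso = perm_order_inv_iso[OF perm]
      \<comment> \<open>\<open>inv w\<close> has its largest value at position \<open>n\<close> and
        a poset isomorphic to that of \<open>w\<close>, so \<open>step\<close> applies to
        it.\<close>
      have "coxeter_element (Suc n) (inv w)"
      proof (rule step)
        show "inv w permutes {1..Suc n}" using perm by (rule permutes_inv)
        show "unique_split {1..Suc n} (perm_order (Suc n) (inv w))"
          by (rule poset_isomorphic_unique_split[OF iso Suc.prems(2)])
        show "\<not> has_square {1..Suc n} (perm_order (Suc n) (inv w))"
          using poset_isomorphic_has_square[OF poset_isomorphic_sym[OF iso]] Suc.prems(3) by blast
        show "inv w n = Suc n" using permutes_inverses(2)[OF perm, of "Suc n"] wn by simp
      qed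
      then have "coxeter_element (Suc n) (inv (inv w))" by (rule coxeter_element_inv)
      then show ?thesis by (simp add: permutes_inv_inv[OF perm])
    qed
  qed
qed

theorem theorem7p3:
  fixes n :: nat
  shows
    "(\<forall>w. w permutes {1..n} \<longrightarrow>
        (two_chain {1..n} (perm_order n w) \<longleftrightarrow> coxeter_element n w))
   \<and> (\<forall>(P :: 'a set) r. two_chain P r \<and> card P = n \<longrightarrow>
        (\<exists>w. coxeter_element n w \<and> poset_isomorphic P r {1..n} (perm_order n w)))
   \<and> (\<forall>v w. coxeter_element n v \<and> coxeter_element n w \<longrightarrow>
        (poset_isomorphic {1..n} (perm_order n v) {1..n} (perm_order n w)
          \<longleftrightarrow> v \<in> {w, inv w}))"
proof (intro conjI allI impI)
  fix w assume w: "w permutes {1..n}"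
  show "two_chain {1..n} (perm_order n w) \<longleftrightarrow> coxeter_element n w"
  proof
    assume tc: "two_chain {1..n} (perm_order n w)"
    then have "unique_split {1..n} (perm_order n w)" by (simp add: two_chain_iff)
    then show "coxeter_element n w"
      using coxeter_element_of_unique_split[OF w] two_chain_no_square[OF tc] by blast
  qed (rule coxeter_element_two_chain)
next
  fix P :: "'a set" and r
  assume P: "two_chain P r \<and> card P = n"
  then have tc: "finite P" "partial_order_on P r" "unique_split P r" by (simp_all add: two_chain_iff)
  then obtain S where "S \<in> splits P r" by (auto simp: unique_split_def)
  then obtain w where w: "w permutes {1..n}" "poset_isomorphic P r {1..n} (perm_order n w)"
    using ex_perm_order_iso[OF tc(1,2)] P by blast
  \<comment> \<open>The 2-chain property passes to the permutation poset, which forces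
    \<open>w\<close> to be a Coxeter element.\<close>
  have "two_chain {1..n} (perm_order n w)"
    using two_chain_iso[OF w(2) perm_order_subset] P by blast
  then have "coxeter_element n w"
    using coxeter_element_of_unique_split[OF w(1)] two_chain_no_square[of "{1..n}" "perm_order n w"]
    by (simp add: two_chain_iff)
  then show "\<exists>w. coxeter_element n w \<and> poset_isomorphic P r {1..n} (perm_order n w)"
    using w(2) by blast
next
  fix v w assume "coxeter_element n v \<and> coxeter_element n w"
  then have v: "v permutes {1..n}" and w: "w permutes {1..n}" and "coxeter_element n w"
    by (blast intro: coxeter_element_permutes)+
  then have uniq: "unique_split {1..n} (perm_order n w)"
    using coxeter_element_two_chain[of n w] by (simp add: two_chain_iff)
  show "poset_isomorphic {1..n} (perm_order n v) {1..n} (perm_order n w) \<longleftrightarrow> v \<in> {w, inv w}"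
  proof
    assume "poset_isomorphic {1..n} (perm_order n v) {1..n} (perm_order n w)"
    then show "v \<in> {w, inv w}" using perm_order_iso_imp[OF v w uniq] by blast
  next
    assume "v \<in> {w, inv w}"
    moreover have "poset_isomorphic {1..n} (perm_order n w) {1..n} (perm_order n w)"
      unfolding poset_isomorphic_def by (intro exI[of _ id]) simp
    ultimately show "poset_isomorphic {1..n} (perm_order n v) {1..n} (perm_order n w)"
      using poset_isomorphic_sym[OF perm_order_inv_iso[OF w]] by blast
  qed
qed

end
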